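(* Let $D$ be a minimal strong digraph and let $C_q$ be a directed cycle of length $q\ge 2$ contained in $D$. Then the number of linear vertices of $D$ is at least $\left\lfloor \frac{q+1}{2}\right\rfloor$.
   Context: An arc $uv$ of a digraph is transitive if there is another directed $uv$-path not using the arc $uv$. A minimal strong digraph is a strongly connected digraph with no transitive arcs. A vertex $v$ of $D$ is linear if its indegree and outdegree in $D$ are both equal to $1$. *)

theory Defs
  imports "Graph_Theory.Graph_Theory"
begin

context pre_digraph
begin

definition transitive_arc :: "'b \<Rightarrow> bool" where
  "transitive_arc e \<longleftrightarrow> e \<in> arcs G \<and> (\<exists>p. apath (tail G e) p (head G e) \<and> e \<notin> set p)"

definition linear_vertex :: "'a \<Rightarrow> bool" where
  "linear_vertex v \<longleftrightarrow> v \<in> verts G \<and> in_degree G v = 1 \<and> out_degree G v = 1"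

end

text \<open>As usual for minimal strong digraphs, digraphs are finite and have neither loops nor
  parallel arcs, which is what the locale \<^locale>\<open>digraph\<close> states.\<close>

locale minimal_strong_digraph = digraph +
  assumes strongly_connected: "strongly_connected G"
    and no_transitive_arcs: "\<And>e. \<not> transitive_arc e"

end

theory Submission
  imports Defs
begin

text \<open>For a strongly connected subgraph \<open>K\<close> with \<open>m\<close> arcs, the sum over the vertices of \<open>K\<close>
  of their degrees in the whole digraph is at most \<open>2 m\<close> plus twice the number of linear
  vertices outside \<open>K\<close>. This is an equality if \<open>K\<close> is spanning, because without transitive arcs
  strongly connected subgraphs are induced, and one descends to smaller \<open>K\<close> by undoing the
  attachment of ears. An ear with \<open>r\<close> inner vertices adds at most \<open>r + 1\<close> arcs, so it suffices
  that its inner vertices \<open>v\<close> satisfy \<open>\<Sum>(deg v + 2 [v linear]) \<ge> 2 r + 2\<close>. Each term is at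
  least \<open>3\<close>, which settles \<open>r \<ge> 2\<close>. For \<open>r = 1\<close> the term is at least \<open>4\<close>: a cycle through \<open>v\<close>
  that uses just one of the two arcs of the ear would make the other one transitive, so \<open>v\<close> has
  indegree \<open>1\<close> iff it has outdegree \<open>1\<close>.

  A cycle of length \<open>q\<close> is itself such a subgraph \<open>K\<close> with \<open>m \<le> q\<close>, and its vertices satisfy
  \<open>deg v + [v linear] \<ge> 3\<close>. Hence the number of linear vertices on the cycle plus twice the
  number of those off it is at least \<open>q\<close>.\<close>

context pre_digraph
begin

definition add_arcs :: "'b set \<Rightarrow> ('a, 'b) pre_digraph" where
  "add_arcs F = \<lparr>verts = verts G \<union> tail G ` F \<union> head G ` F, arcs = arcs G \<union> F,
    tail = tail G, head = head G\<rparr>"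

lemma add_arcs_simps [simp]:
  "verts (add_arcs F) = verts G \<union> tail G ` F \<union> head G ` F"
  "arcs (add_arcs F) = arcs G \<union> F"
  "tail (add_arcs F) = tail G"
  "head (add_arcs F) = head G"
  by (simp_all add: add_arcs_def)

definition degree :: "'a \<Rightarrow> nat" where
  "degree v = in_degree G v + out_degree G v"

definition linear_verts :: "'a set" where
  "linear_verts = {v. linear_vertex v}"

definition ear :: "'a set \<Rightarrow> 'a \<Rightarrow> 'b awalk \<Rightarrow> 'a \<Rightarrow> bool" where
  "ear S x p y \<longleftrightarrow> awalk x p y \<and> x \<in> S \<and> y \<in> S \<and>
    inner_verts p \<noteq> [] \<and> distinct (inner_verts p) \<and> set (inner_verts p) \<inter> S = {}"

definition slack :: "('a, 'b) pre_digraph \<Rightarrow> int" where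
  "slack K = 2 * int (card (arcs K)) + 2 * int (card (linear_verts - verts K)) -
    int (\<Sum>v\<in>verts K. degree v)"

end

context wf_digraph
begin

lemma subgraph_add_arcs: "subgraph G (add_arcs F)"
  by (intro subgraphI wf_digraph) (auto simp: compatible_def intro!: wf_digraph.intro)

lemma strongly_connected_add_awalk:
  assumes "strongly_connected G" "x \<in> verts G" "y \<in> verts G" "cas x p y"
  shows "strongly_connected (add_arcs (set p))"
proof -
  let ?H = "add_arcs (set p)"
  have sub: "subgraph G ?H"
    by (rule subgraph_add_arcs)
  then interpret H: wf_digraph ?H
    by blast
  have walk: "H.awalk x p y"
    using assms sub by (auto simp: H.awalk_def compatible_cas[of ?H G] compatible_def)
  have from_x_to_y: "x \<rightarrow>\<^sup>*\<^bsub>?H\<^esub> v \<and> v \<rightarrow>\<^sup>*\<^bsub>?H\<^esub> y" if "v \<in> verts ?H" for v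
  proof (cases "v \<in> verts G")
    case True
    then show ?thesis
      using assms sub by (auto intro: H.reachable_mono)
  next
    case False
    then have "v \<in> set (H.awalk_verts x p)"
      using that H.set_awalk_verts[OF walk] by auto
    then show ?thesis
      using walk by (auto intro: H.awalk_verts_reachable_from H.awalk_verts_reachable_to)
  qed
  have "y \<rightarrow>\<^sup>*\<^bsub>?H\<^esub> x"
    using assms sub by (auto intro: H.reachable_mono)
  with from_x_to_y have "u \<rightarrow>\<^sup>*\<^bsub>?H\<^esub> v" if "u \<in> verts ?H" "v \<in> verts ?H" for u v
    using that by (meson H.reachable_trans)
  then show ?thesis
    using assms(2) by (intro strongly_connectedI) auto
qed

lemma strongly_connected_subgraph_add_awalkE:
  assumes strong_sub: "subgraph K G" "strongly_connected K"
    and walk: "awalk x p y" "x \<in> verts K" "y \<in> verts K"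
  obtains K' where "subgraph K' G" "strongly_connected K'"
    "verts K' = verts K \<union> set (awalk_verts x p)" "arcs K' = arcs K \<union> set p"
proof -
  interpret K: wf_digraph K
    using strong_sub(1) by blast
  let ?K' = "K.add_arcs (set p)"
  have K_in_G: "verts K \<subseteq> verts G" "arcs K \<subseteq> arcs G" "compatible G K"
    using strong_sub(1) by auto
  have verts_eq: "verts ?K' = verts K \<union> set (awalk_verts x p)"
    using walk(2) K_in_G(3) set_awalk_verts[OF walk(1)] by (auto simp: compatible_def)
  have "wf_digraph ?K'"
    using K.subgraph_add_arcs by blast
  then have "subgraph ?K' G"
    using K_in_G walk(1) unfolding subgraph_def verts_eq
    by (auto simp: compatible_def wf_digraph elim!: awalkE')
  moreover have "strongly_connected ?K'"
    using strong_sub(2) walk compatible_cas[OF K_in_G(3)]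
    by (intro K.strongly_connected_add_awalk[of x y p]) (auto simp: awalk_def)
  ultimately show thesis
    using verts_eq by (intro that[of ?K']) auto
qed

lemma strongly_connected_subgraph_apathE:
  assumes "subgraph K G" "strongly_connected K" "u \<in> verts K" "v \<in> verts K"
  obtains p where "apath u p v" "set p \<subseteq> arcs K"
proof -
  interpret K: wf_digraph K
    using assms(1) by blast
  obtain p where path: "K.apath u p v"
    using assms(2-4) K.reachable_apath by blast
  show thesis
  proof
    show "apath u p v"
      using path assms(1) by (rule subgraph_apath_imp_apath)
    show "set p \<subseteq> arcs K"
      using path by (auto simp: K.apath_def)
  qed
qed

lemma strongly_connected_return_apathE:
  assumes "strongly_connected G" "e \<in> arcs G"
  obtains p where "apath (head G e) p (tail G e)"
proof -
  have "head G e \<rightarrow>\<^sup>* tail G e"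
    using assms by auto
  then show thesis
    unfolding reachable_apath using that by blast
qed

lemma cycle_with_hdE:
  assumes "strongly_connected G" "e \<in> arcs G"
  obtains c where "cycle c" "awalk (tail G e) c (tail G e)" "hd c = e"
proof -
  obtain p where "apath (head G e) p (tail G e)"
    using assms by (rule strongly_connected_return_apathE)
  then have "awalk (tail G e) (e # p) (tail G e)" "cycle (e # p)"
    using assms(2) by (auto simp: apath_def awalk_Cons_iff cycle_def)
  then show thesis
    by (intro that[of "e # p"]) auto
qed

lemma cycle_with_lastE:
  assumes "strongly_connected G" "e \<in> arcs G"
  obtains c where "cycle c" "awalk (head G e) c (head G e)" "last c = e"
proof -
  obtain p where path: "apath (head G e) p (tail G e)"
    using assms by (rule strongly_connected_return_apathE)
  then have closed: "awalk (head G e) (p @ [e]) (head G e)"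
    using assms(2) by (auto simp: apath_def awalk_simps)
  moreover have "distinct (tl (awalk_verts (head G e) (p @ [e])))"
    using path closed unfolding awalk_verts_append[OF closed]
    by (cases p) (auto simp: apath_def awalk_Cons_iff)
  ultimately show thesis
    by (intro that[of "p @ [e]"]) (auto simp: cycle_def)
qed

lemma (in loopfree_digraph) cycle_awalkE:
  assumes "cycle c" "awalk v c v"
  obtains g q h where "c = g # q @ [h]" "g \<in> out_arcs G v" "h \<in> in_arcs G v"
    "awalk (head G g) q (tail G h)" "v \<notin> set (awalk_verts (head G g) q)"
proof -
  obtain u where cycle: "distinct (tl (awalk_verts u c))" "2 \<le> length c"
    using assms(1) by (auto simp: cycle_digraph_conv)
  then obtain g c' where "c = g # c'" "c' \<noteq> []"
    by (cases c) (auto simp: Suc_le_eq)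
  then obtain q h where c_eq: "c = g # q @ [h]"
    by (cases c' rule: rev_cases) auto
  have first_arc: "g \<in> out_arcs G v" and tail_walk: "awalk (head G g) (q @ [h]) v"
    using assms(2) unfolding c_eq awalk_Cons_iff by auto
  then have last_arc: "h \<in> in_arcs G v" "awalk (head G g) q (tail G h)"
    by (auto simp: awalk_simps)
  have "v \<notin> set (awalk_verts (head G g) q)"
    using cycle(1) last_arc(1) awalk_verts_append[OF tail_walk] by (simp add: c_eq)
  then show thesis
    using c_eq first_arc last_arc by (intro that)
qed

lemma awalk_to_first_in_setE:
  assumes "apath v p y" "v \<notin> S" "y \<in> S"
  obtains q z where "awalk v q z" "z \<in> S" "q \<noteq> []"
    "distinct (map (tail G) q)" "set (map (tail G) q) \<inter> S = {}"
proof -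
  have "p \<noteq> []" "head G (last p) = y"
    using assms by (auto simp: apath_def awalk_simps awalk_verts_conv split: if_splits)
  then have "\<exists>f\<in>set p. head G f \<in> S"
    using assms(3) last_in_set by blast
  then obtain q f r where split: "p = q @ f # r" "head G f \<in> S" "\<forall>e\<in>set q. head G e \<notin> S"
    using split_list_first_prop[of p "\<lambda>e. head G e \<in> S"] by blast
  then have prefix: "apath v q (tail G f)" "f \<in> arcs G"
    using assms(1) by (auto simp: apath_append_iff apath_simps)
  then have cas: "cas v q (tail G f)"
    by (auto simp: apath_def)
  have tails: "map (tail G) (q @ [f]) = awalk_verts v q"
    using prefix by (auto simp: awalk_verts_conv apath_def)
  show thesis
  proof (rule that)
    show "awalk v (q @ [f]) (head G f)"
      using prefix by (blast intro: awalk_appendI awalkI_apath arc_implies_awalk)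
    show "distinct (map (tail G) (q @ [f]))"
      unfolding tails using prefix(1) by (simp add: apath_def)
    have "awalk_verts v q = v # map (head G) q"
      using cas awalk_verts_conv'[OF cas] by (cases "q = []") (auto simp: cas_simp)
    then show "set (map (tail G) (q @ [f])) \<inter> S = {}"
      unfolding tails using split(3) assms(2) by auto
  qed (use split(2) in auto)
qed

lemma awalk_verts_ear:
  assumes "ear S x p y"
  shows "awalk_verts x p = x # inner_verts p @ [y]"
proof -
  have "hd (awalk_verts x p) = x" "last (awalk_verts x p) = y" "tl (awalk_verts x p) \<noteq> []"
    using assms by (auto simp: ear_def inner_verts_conv[of p x])
  then show ?thesis
    unfolding inner_verts_conv[of p x]
    by (metis append_butlast_last_id awalk_verts_non_Nil last_tl list.collapse)
qed

lemma length_ear: "ear S x p y \<Longrightarrow> length p = Suc (card (set (inner_verts p)))"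
  using awalk_verts_ear[of S x p y] length_awalk_verts[of x p]
  by (simp add: ear_def distinct_card)

lemma inner_verts_ear_subset:
  assumes "ear S x p y"
  shows "set (inner_verts p) \<subseteq> verts G"
proof -
  have "set (awalk_verts x p) \<subseteq> verts G"
    using assms unfolding ear_def awalk_conv by blast
  then show ?thesis
    using awalk_verts_ear[OF assms] by simp
qed

lemma strongly_connected_earE:
  assumes "strongly_connected G" "S \<subset> verts G" "S \<noteq> {}"
  obtains x p y where "ear S x p y"
proof -
  obtain s w where "s \<in> S" "w \<in> verts G" "w \<notin> S"
    using assms by blast
  then have "s \<rightarrow>\<^sup>* w"
    using assms(1,2) by blast
  then have "\<exists>x v. x \<in> S \<and> v \<notin> S \<and> (x, v) \<in> arcs_ends G"
    using \<open>s \<in> S\<close> \<open>w \<notin> S\<close> by (induction rule: reachable_induct) auto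
  then obtain e where leaving: "e \<in> arcs G" "tail G e \<in> S" "head G e \<notin> S"
    by auto
  then obtain p where "apath (head G e) p (tail G e)"
    using assms(1) strongly_connected_return_apathE by blast
  then obtain q y where "awalk (head G e) q y" "y \<in> S" "q \<noteq> []"
    "distinct (map (tail G) q)" "set (map (tail G) q) \<inter> S = {}"
    using awalk_to_first_in_setE leaving by blast
  then have "ear S (tail G e) (e # q) y"
    using leaving by (auto simp: ear_def inner_verts_def awalk_Cons_iff)
  then show thesis
    by (rule that)
qed

end

context fin_digraph
begin

lemma degree_handshake: "(\<Sum>v\<in>verts G. degree v) = 2 * card (arcs G)"
proof -
  have "(\<Sum>v\<in>verts G. in_degree G v) = card (arcs G)"
    using sum.group[of "arcs G" "verts G" "head G" "\<lambda>_. 1::nat"] head_in_verts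
    by (simp add: in_degree_def in_arcs_def image_subset_iff)
  moreover have "(\<Sum>v\<in>verts G. out_degree G v) = card (arcs G)"
    using sum.group[of "arcs G" "verts G" "tail G" "\<lambda>_. 1::nat"] tail_in_verts
    by (simp add: out_degree_def out_arcs_def image_subset_iff)
  ultimately show ?thesis
    by (simp add: degree_def sum.distrib)
qed

lemma in_degree_pos: "e \<in> in_arcs G v \<Longrightarrow> in_degree G v > 0"
  unfolding in_degree_def by (metis card_gt_0_iff empty_iff finite_in_arcs)

lemma out_degree_pos: "e \<in> out_arcs G v \<Longrightarrow> out_degree G v > 0"
  unfolding out_degree_def by (metis card_gt_0_iff empty_iff finite_out_arcs)

lemma finite_linear_verts: "finite linear_verts"
  by (rule finite_subset[of _ "verts G"]) (auto simp: linear_verts_def linear_vertex_def)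

lemma degree_add_linear_ge_3:
  assumes "strongly_connected G" "v \<in> verts G" "w \<in> verts G" "v \<noteq> w"
  shows "3 \<le> degree v + of_bool (v \<in> linear_verts)"
proof -
  have "v \<rightarrow>\<^sup>+ w" "w \<rightarrow>\<^sup>+ v"
    using assms by auto
  then obtain e f where "e \<in> out_arcs G v" "f \<in> in_arcs G v"
    by (metis reachableE tranclD tranclD2 in_in_arcs_conv in_out_arcs_conv)
  then have "in_degree G v > 0" "out_degree G v > 0"
    by (blast intro: in_degree_pos out_degree_pos)+
  then show ?thesis
    using assms(2) unfolding degree_def linear_verts_def linear_vertex_def by auto
qed

end

context minimal_strong_digraph
begin

lemma awalk_uses_arc:
  assumes "e \<in> arcs G" "awalk (tail G e) p (head G e)"
  shows "e \<in> set p"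
proof (rule ccontr)
  assume "e \<notin> set p"
  then have "e \<notin> set (awalk_to_apath p)"
    using awalk_to_apath_subset[OF assms(2)] by blast
  then have "transitive_arc e"
    using assms apath_awalk_to_apath by (auto simp: transitive_arc_def)
  then show False
    using no_transitive_arcs by blast
qed

lemma strongly_connected_subgraph_induced:
  assumes "subgraph K G" "strongly_connected K"
  shows "induced_subgraph K G"
proof
  have "e \<in> arcs K" if "e \<in> arcs G" "tail G e \<in> verts K" "head G e \<in> verts K" for e
  proof -
    obtain p where "apath (tail G e) p (head G e)" "set p \<subseteq> arcs K"
      using strongly_connected_subgraph_apathE[OF assms \<open>tail G e \<in> _\<close> \<open>head G e \<in> _\<close>] by blast
    then show ?thesis
      using awalk_uses_arc \<open>e \<in> arcs G\<close> by (auto simp: apath_def)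
  qed
  moreover have "e \<in> arcs G \<and> tail G e \<in> verts K \<and> head G e \<in> verts K" if "e \<in> arcs K" for e
  proof -
    interpret K: wf_digraph K
      using assms(1) by blast
    have "compatible G K" "arcs K \<subseteq> arcs G"
      using assms(1) by auto
    then show ?thesis
      using that K.wellformed by (auto simp: compatible_def)
  qed
  ultimately show "arcs K = {e \<in> arcs G. tail G e \<in> verts K \<and> head G e \<in> verts K}"
    by blast
qed (rule assms(1))

context
  fixes K v e f
  assumes strong_sub: "subgraph K G" "strongly_connected K"
    and ear_arcs: "e \<in> in_arcs G v" "f \<in> out_arcs G v"
    and ends_in: "tail G e \<in> verts K" "head G f \<in> verts K" and inner_notin: "v \<notin> verts K"
begin

lemma single_vertex_ear_cycle_iff:
  assumes "cycle c" "awalk v c v"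
  shows "last c = e \<longleftrightarrow> hd c = f"
proof -
  obtain g q h where c_eq: "c = g # q @ [h]"
    and closed: "g \<in> out_arcs G v" "h \<in> in_arcs G v" "awalk (head G g) q (tail G h)"
    and v_once: "v \<notin> set (awalk_verts (head G g) q)"
    using assms by (rule cycle_awalkE)
  obtain r where detour: "apath (tail G e) r (head G f)" "set r \<subseteq> arcs K"
    using strong_sub ends_in by (rule strongly_connected_subgraph_apathE)
  have "e \<notin> set q" "f \<notin> set q"
    using v_once ear_arcs
      awalk_verts_arc1[of f q "head G g"] awalk_verts_arc2[OF closed(3), of e] by auto
  moreover have "e \<notin> set r" "f \<notin> set r"
    using detour(2) strongly_connected_subgraph_induced[OF strong_sub] ear_arcs inner_notin
    by (auto simp: induced_subgraph_def)
  moreover have "f \<in> set (g # q @ r)" if "h = e"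
    using that ear_arcs closed awalkI_apath[OF detour(1)]
    by (intro awalk_uses_arc) (auto simp: awalk_simps)
  moreover have "e \<in> set (r @ q @ [h])" if "g = f"
    using that ear_arcs closed awalkI_apath[OF detour(1)]
    by (intro awalk_uses_arc) (auto simp: awalk_simps)
  ultimately show ?thesis
    by (auto simp: c_eq)
qed

lemma single_vertex_ear_in_arcs_iff: "in_arcs G v = {e} \<longleftrightarrow> out_arcs G v = {f}"
proof
  assume unique_in: "in_arcs G v = {e}"
  have "g = f" if leaving: "g \<in> out_arcs G v" for g
  proof -
    obtain c where through_v: "cycle c" "awalk v c v" "hd c = g"
      using cycle_with_hdE[OF strongly_connected] leaving by (metis in_out_arcs_conv)
    then have "last c \<in> in_arcs G v"
      by (auto intro: cycle_awalkE[OF through_v(1,2)])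
    then show ?thesis
      using single_vertex_ear_cycle_iff[OF through_v(1,2)] through_v(3) unique_in by blast
  qed
  then show "out_arcs G v = {f}"
    using ear_arcs(2) by blast
next
  assume unique_out: "out_arcs G v = {f}"
  have "h = e" if entering: "h \<in> in_arcs G v" for h
  proof -
    obtain c where through_v: "cycle c" "awalk v c v" "last c = h"
      using cycle_with_lastE[OF strongly_connected] entering by (metis in_in_arcs_conv)
    then have "hd c \<in> out_arcs G v"
      by (auto intro: cycle_awalkE[OF through_v(1,2)])
    then show ?thesis
      using single_vertex_ear_cycle_iff[OF through_v(1,2)] through_v(3) unique_out by blast
  qed
  then show "in_arcs G v = {e}"
    using ear_arcs(1) by blast
qed

lemma single_vertex_ear_degree_add_linear_ge_4: "4 \<le> degree v + 2 * of_bool (v \<in> linear_verts)"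
proof -
  have card_eq_1: "card A = 1 \<longleftrightarrow> A = {a}" if "a \<in> A" for a :: 'b and A
    using that by (auto simp: card_1_singleton_iff)
  have "in_degree G v = 1 \<longleftrightarrow> in_arcs G v = {e}" "out_degree G v = 1 \<longleftrightarrow> out_arcs G v = {f}"
    unfolding in_degree_def out_degree_def using ear_arcs by (simp_all only: card_eq_1)
  then have "in_degree G v = 1 \<longleftrightarrow> out_degree G v = 1"
    using single_vertex_ear_in_arcs_iff by blast
  moreover have "v \<in> verts G"
    using ear_arcs by auto
  moreover have "in_degree G v > 0" "out_degree G v > 0"
    using ear_arcs by (blast intro: in_degree_pos out_degree_pos)+
  ultimately show ?thesis
    unfolding degree_def linear_verts_def linear_vertex_def by auto
qed

end

lemma ear_sum_degree_add_linear_ge: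
  assumes "subgraph K G" "strongly_connected K" and ear: "ear (verts K) x p y"
  shows "2 * length p \<le> (\<Sum>v\<in>set (inner_verts p). degree v + 2 * of_bool (v \<in> linear_verts))"
proof (cases "length p = 2")
  case True
  then obtain e f where p_eq: "p = [e, f]"
    by (auto simp: numeral_2_eq_2 length_Suc_conv)
  have "e \<in> in_arcs G (tail G f)" "f \<in> out_arcs G (tail G f)"
    "tail G e \<in> verts K" "head G f \<in> verts K" "tail G f \<notin> verts K"
    using ear by (auto simp: p_eq ear_def inner_verts_def awalk_simps)
  from single_vertex_ear_degree_add_linear_ge_4[OF assms(1,2) this] show ?thesis
    by (simp add: p_eq inner_verts_def)
next
  case False
  have "card (set (inner_verts p)) > 0"
    using ear by (simp add: ear_def card_gt_0_iff)
  with False have "2 * length p \<le> 3 * card (set (inner_verts p))"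
    using length_ear[OF ear] by linarith
  also have "\<dots> = (\<Sum>v\<in>set (inner_verts p). 3)"
    by simp
  also have "\<dots> \<le> (\<Sum>v\<in>set (inner_verts p). degree v + 2 * of_bool (v \<in> linear_verts))"
  proof (rule sum_mono)
    fix v
    assume "v \<in> set (inner_verts p)"
    then have "v \<in> verts G" "x \<in> verts G" "v \<noteq> x"
      using ear inner_verts_ear_subset[OF ear] by (auto simp: ear_def)
    then show "3 \<le> degree v + 2 * of_bool (v \<in> linear_verts)"
      using degree_add_linear_ge_3[OF strongly_connected, of v x] by auto
  qed
  finally show ?thesis .
qed

lemma attach_ear_slack_leE:
  assumes strong_sub: "subgraph K G" "strongly_connected K" and ear: "ear (verts K) x p y"
  obtains K' where "subgraph K' G" "strongly_connected K'"
    "verts K \<subset> verts K'" "slack K' \<le> slack K"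
proof -
  define I where "I = set (inner_verts p)"
  have inner: "I \<inter> verts K = {}" "I \<noteq> {}" "finite I"
    using ear by (auto simp: I_def ear_def)
  have "awalk x p y" and ends: "x \<in> verts K" "y \<in> verts K"
    using ear by (auto simp: ear_def)
  with strong_sub obtain K' where strong_sub': "subgraph K' G" "strongly_connected K'"
    and "verts K' = verts K \<union> set (awalk_verts x p)" and arcs_eq: "arcs K' = arcs K \<union> set p"
    by (rule strongly_connected_subgraph_add_awalkE)
  then have verts_eq: "verts K' = verts K \<union> I"
    using ends by (auto simp: awalk_verts_ear[OF ear] I_def)
  have "finite (verts K)"
    using strong_sub(1) by (meson finite_subset finite_verts subgraph_imp_subverts)
  then have "(\<Sum>v\<in>verts K'. degree v) = (\<Sum>v\<in>verts K. degree v) + (\<Sum>v\<in>I. degree v)"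
    unfolding verts_eq using inner by (intro sum.union_disjoint) auto
  moreover have "2 * length p \<le> (\<Sum>v\<in>I. degree v) + 2 * card (I \<inter> linear_verts)"
    using ear_sum_degree_add_linear_ge[OF strong_sub ear]
    by (simp add: I_def sum.distrib sum_distrib_left[symmetric])
  moreover have "card (arcs K') \<le> card (arcs K) + length p"
    unfolding arcs_eq using card_Un_le[of "arcs K" "set p"] card_length[of p] by linarith
  moreover have "card (linear_verts - verts K) =
      card (I \<inter> linear_verts) + card (linear_verts - verts K')"
  proof -
    have "(linear_verts - verts K) \<inter> I = I \<inter> linear_verts"
      "linear_verts - verts K - I = linear_verts - verts K'"
      using inner(1) by (auto simp: verts_eq)
    then show ?thesis
      using card_Int_Diff[of "linear_verts - verts K" I] finite_linear_verts by simp
  qed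
  ultimately have "slack K' \<le> slack K"
    unfolding slack_def by linarith
  moreover have "verts K \<subset> verts K'"
    using inner by (auto simp: verts_eq)
  ultimately show thesis
    using strong_sub' by (intro that)
qed

lemma slack_nonneg:
  assumes "subgraph K G" "strongly_connected K"
  shows "0 \<le> slack K"
  using assms
proof (induction "card (verts G - verts K)" arbitrary: K rule: less_induct)
  case less
  show ?case
  proof (cases "verts K = verts G")
    case True
    then have "arcs K = arcs G"
      using strongly_connected_subgraph_induced[OF less.prems]
      by (auto simp: induced_subgraph_def)
    with True show ?thesis
      by (simp add: slack_def degree_handshake del: of_nat_sum)
  next
    case False
    then have "verts K \<subset> verts G" "verts K \<noteq> {}"
      using less.prems by (auto simp: strongly_connected_def)
    then obtain x p y where "ear (verts K) x p y"
      by (rule strongly_connected_earE[OF strongly_connected])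
    with less.prems obtain K' where strong_sub': "subgraph K' G" "strongly_connected K'"
      and larger: "verts K \<subset> verts K'" and "slack K' \<le> slack K"
      by (rule attach_ear_slack_leE)
    have "verts G - verts K' \<subset> verts G - verts K"
      using subgraph_imp_subverts[OF strong_sub'(1)] larger by blast
    then have "card (verts G - verts K') < card (verts G - verts K)"
      by (intro psubset_card_mono) auto
    then have "0 \<le> slack K'"
      using strong_sub' by (rule less.hyps)
    with \<open>slack K' \<le> slack K\<close> show ?thesis
      by simp
  qed
qed

lemma cycle_subgraphE:
  assumes "cycle c"
  obtains K where "subgraph K G" "strongly_connected K"
    "card (verts K) = length c" "arcs K = set c"
proof -
  obtain u where closed: "awalk u c u" "distinct (tl (awalk_verts u c))" "c \<noteq> []"
    using assms by (auto simp: cycle_def)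
  have "subgraph (G \<restriction> {u}) G"
    using closed(1) by (intro induced_imp_subgraph induced_induce) auto
  moreover have "strongly_connected (G \<restriction> {u})"
    using wf_digraph.reachable_refl[OF wellformed_induce_subgraph[of "{u}"]]
    by (intro strongly_connectedI) auto
  ultimately obtain K where strong_sub: "subgraph K G" "strongly_connected K"
    and verts_eq: "verts K = verts (G \<restriction> {u}) \<union> set (awalk_verts u c)"
    and arcs_eq: "arcs K = arcs (G \<restriction> {u}) \<union> set c"
    using closed(1) by (rule strongly_connected_subgraph_add_awalkE) simp_all
  have "u \<in> set (tl (awalk_verts u c))"
    using awlast_of_awalk[OF closed(1)] closed(3) last_in_set[of "tl (awalk_verts u c)"]
    by (cases c) simp_all
  then have "verts K = set (tl (awalk_verts u c))"
    using verts_eq closed(1) by (cases c) auto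
  then have "card (verts K) = length c"
    using closed(2) by (simp add: distinct_card length_awalk_verts)
  moreover have "arcs K = set c"
    using arcs_eq no_loops by fastforce
  ultimately show thesis
    using strong_sub by (intro that)
qed

lemma length_cycle_le_twice_card_linear_verts:
  assumes "cycle c"
  shows "length c \<le> 2 * card linear_verts"
proof -
  obtain K where strong_sub: "subgraph K G" "strongly_connected K"
    and card_verts: "card (verts K) = length c" and arcs_eq: "arcs K = set c"
    using assms by (rule cycle_subgraphE)
  have "verts K \<subseteq> verts G"
    using strong_sub(1) by auto
  then have "finite (verts K)"
    by (rule finite_subset) simp
  have "3 * length c = (\<Sum>v\<in>verts K. 3)"
    using card_verts by simp
  also have "\<dots> \<le> (\<Sum>v\<in>verts K. degree v + of_bool (v \<in> linear_verts))"
  proof (rule sum_mono)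
    fix v
    assume "v \<in> verts K"
    moreover from this obtain w where "w \<in> verts K" "v \<noteq> w"
      using card_verts assms \<open>finite (verts K)\<close>
      by (metis card_le_Suc0_iff_eq cycle_digraph_conv not_less_eq_eq numeral_2_eq_2)
    ultimately show "3 \<le> degree v + of_bool (v \<in> linear_verts)"
      using strongly_connected \<open>verts K \<subseteq> verts G\<close> by (intro degree_add_linear_ge_3) auto
  qed
  also have "\<dots> = (\<Sum>v\<in>verts K. degree v) + card (linear_verts \<inter> verts K)"
    using \<open>finite (verts K)\<close> by (simp add: sum.distrib Int_commute)
  also have "(\<Sum>v\<in>verts K. degree v) \<le> 2 * card (arcs K) + 2 * card (linear_verts - verts K)"
    using slack_nonneg[OF strong_sub] unfolding slack_def by linarith
  also have "card (arcs K) \<le> length c"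
    unfolding arcs_eq by (rule card_length)
  finally have "length c \<le> card (linear_verts \<inter> verts K) + 2 * card (linear_verts - verts K)"
    by simp
  also have "\<dots> \<le> 2 * card linear_verts"
    using card_Int_Diff[OF finite_linear_verts, of "verts K"] by simp
  finally show ?thesis .
qed

end

theorem theorem4:
  fixes D :: "('a, 'b) pre_digraph" and C :: "'b awalk" and q :: nat
  assumes "minimal_strong_digraph D"
    and "pre_digraph.cycle D C" and "length C = q" and "q \<ge> 2"
  shows "card {v. pre_digraph.linear_vertex D v} \<ge> (q + 1) div 2"
proof -
  interpret minimal_strong_digraph D
    by (rule assms(1))
  have "q \<le> 2 * card {v. linear_vertex v}"
    using length_cycle_le_twice_card_linear_verts[OF assms(2)] assms(3)
    by (simp add: linear_verts_def)
  then show ?thesis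
    by simp
qed

end
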